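(* Let $f\in C(\mathbb{R})$ be nondecreasing. Let $u\in C^2(\mathbb{R}^n)$ be a solution of $$\mathcal{I}u(x)=f(u(x))\quad\text{for any } x\in\mathbb{R}^n.$$ Then, if $$u(x)\leq K\,(1+|x|^\kappa)\quad\text{for any } x\in\mathbb{R}^n,$$ for some $K\geq 0$ and $\kappa\in[0,2s)$, we have that $$\mathcal{I}u(x)\leq 0\quad\text{for any } x\in\mathbb{R}^n.$$ Similarly, if $$u(x)\geq -K\,(1+|x|^\kappa)\quad\text{for any } x\in\mathbb{R}^n,$$ for some $K\geq 0$ and $\kappa\in[0,2s)$, we have that $$\mathcal{I}u(x)\geq 0\quad\text{for any } x\in\mathbb{R}^n.$$
   Context: Fix $n\geq 1$ and $s\in(0,1)$. Let $\mu$ be a (nonnegative Borel) measure on the unit sphere $S^{n-1}\subset\mathbb{R}^n$ (the "spectral measure") for which there exist $\lambda,\Lambda\in(0,+\infty)$ such that $$\inf_{\nu\in S^{n-1}}\int_{S^{n-1}}|\nu\cdot\vartheta|^{2s}\,d\mu(\vartheta)\geq\lambda\quad\text{and}\quad\mu(S^{n-1})\leq\Lambda.$$ The operator $\mathcal{I}$ is defined by $$\mathcal{I}u(x):=\int_{S^{n-1}\times\mathbb{R}}\big(u(x+\vartheta r)+u(x-\vartheta r)-2u(x)\big)\,\frac{d\mu(\vartheta)\,dr}{|r|^{1+2s}},$$ where $dr$ is Lebesgue measure on $\mathbb{R}$. A solution of $\mathcal{I}u=f(u)$ is a function for which the integral defining $\mathcal{I}u(x)$ makes sense and the equation holds pointwise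 at every $x\in\mathbb{R}^n$. *)

theory Defs
  imports "HOL-Analysis.Analysis"
begin

definition spectral_measure ::
    "real \<Rightarrow> real \<Rightarrow> real \<Rightarrow> (real ^ 'n) measure \<Rightarrow> bool" where
  "spectral_measure s l L \<mu> \<longleftrightarrow>
     sets \<mu> = sets (restrict_space borel (sphere 0 1)) \<and>
     (INF \<nu>\<in>sphere 0 1. \<integral>\<^sup>+ \<theta>. ennreal (\<bar>\<nu> \<bullet> \<theta>\<bar> powr (2 * s)) \<partial>\<mu>) \<ge> ennreal l \<and>
     emeasure \<mu> (sphere 0 1) \<le> ennreal L"

text \<open>The value at \<open>r = 0\<close> is \<open>0\<close> (division by zero); this is irrelevant, since \<open>{r. r = 0}\<close> is
  a null set.\<close>

definition stable_integrand ::
    "real \<Rightarrow> (real ^ 'n \<Rightarrow> real) \<Rightarrow> real ^ 'n \<Rightarrow> (real ^ 'n) \<times> real \<Rightarrow> real" where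
  "stable_integrand s u x = (\<lambda>(\<theta>, r).
     (u (x + r *\<^sub>R \<theta>) + u (x - r *\<^sub>R \<theta>) - 2 * u x) / \<bar>r\<bar> powr (1 + 2 * s))"

definition stable_op ::
    "real \<Rightarrow> (real ^ 'n) measure \<Rightarrow> (real ^ 'n \<Rightarrow> real) \<Rightarrow> real ^ 'n \<Rightarrow> real" where
  "stable_op s \<mu> u x = integral\<^sup>L (\<mu> \<Otimes>\<^sub>M lborel) (stable_integrand s u x)"

text \<open>Integrability is required explicitly because the Bochner integral of a non-integrable
  function is \<open>0\<close> by convention.\<close>

definition solution ::
    "real \<Rightarrow> (real ^ 'n) measure \<Rightarrow> (real \<Rightarrow> real) \<Rightarrow> (real ^ 'n \<Rightarrow> real) \<Rightarrow> bool" where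
  "solution s \<mu> f u \<longleftrightarrow>
     (\<forall>x. integrable (\<mu> \<Otimes>\<^sub>M lborel) (stable_integrand s u x) \<and> stable_op s \<mu> u x = f (u x))"

definition C2 :: "('a::real_normed_vector \<Rightarrow> 'b::real_normed_vector) \<Rightarrow> bool" where
  "C2 u \<longleftrightarrow> (\<exists>(u' :: 'a \<Rightarrow> 'a \<Rightarrow>\<^sub>L 'b) (u'' :: 'a \<Rightarrow> 'a \<Rightarrow>\<^sub>L 'a \<Rightarrow>\<^sub>L 'b).
     (\<forall>x. (u has_derivative blinfun_apply (u' x)) (at x)) \<and>
     (\<forall>x. (u' has_derivative blinfun_apply (u'' x)) (at x)) \<and>
     continuous_on UNIV u'')"

text \<open>The function \<open>1 + |x|^\<kappa>\<close> with the usual convention \<open>t^0 = 1\<close> for all \<open>t \<ge> 0\<close>, whereas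
  \<open>0 powr 0 = 0\<close>.\<close>

definition growth :: "real \<Rightarrow> 'a::real_normed_vector \<Rightarrow> real" where
  "growth \<kappa> x = 1 + (if \<kappa> = 0 then 1 else norm x powr \<kappa>)"

end

theory Submission
  imports Defs
begin

text \<open>
  Only the upper bound needs an argument: replacing \<open>u\<close> by \<open>- u\<close> and \<open>f\<close> by
  \<open>\<lambda>t. - f (- t)\<close> exchanges the two halves of the theorem.

  If \<open>u\<close> attained its maximum at a point \<open>z\<close>, the integrand of the operator at \<open>z\<close> would be
  nonpositive, so \<open>f (u z) \<le> 0\<close>, and monotonicity of \<open>f\<close> would carry \<open>f (u x) \<le> f (u z) \<le> 0\<close> to
  every \<open>x\<close>. In general there is no maximum, but the growth of \<open>u\<close> is beaten by the barrier
  \<open>\<phi> x = (1 + |x|\<^sup>2) powr p\<close> with \<open>\<kappa> < 2 * p < 2 * s\<close>, so that \<open>u - \<epsilon> * \<phi>\<close> does attain its maximum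
  at some \<open>z\<close> (lemma \<open>penalized_attains_max\<close>). At that point the second differences of \<open>u\<close> are at
  most \<open>\<epsilon>\<close> times those of \<open>\<phi>\<close>. The latter have a majorant that does not depend on the base
  point and is integrable against the kernel (lemmas \<open>barrier_second_difference_le\<close> and
  \<open>integrable_levy_kernel_bound\<close>). Hence \<open>f (u z) \<le> \<epsilon> * C\<close> with \<open>C\<close> independent of \<open>\<epsilon>\<close> and
  \<open>z\<close>. Since \<open>u x - \<epsilon> * \<phi> x \<le> u z\<close>, monotonicity gives \<open>f (u x - \<epsilon> * \<phi> x) \<le> \<epsilon> * C\<close>, and
  \<open>\<epsilon> \<rightarrow> 0\<close> concludes by continuity of \<open>f\<close>.
\<close>

section \<open>Second differences of the barrier\<close>

text \<open>Factor out \<open>(a + b) powr (p - 1)\<close>, which is decreasing in each of its arguments because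
  \<open>p \<le> 1\<close>. The bound by \<open>b\<close> makes the kernel integrable near the origin, the bound by
  \<open>b powr p\<close> makes it integrable at infinity.\<close>

lemma powr_increment_le:
  fixes a b p :: real
  assumes "1 \<le> a" "0 \<le> b" "0 < p" "p \<le> 1"
  shows "(a + b) powr p - a powr p \<le> min b (b powr p)"
proof (cases "b = 0")
  case False
  then have b: "0 < b" using assms by simp
  have "(a + b) powr p \<le> (a + b) * a powr (p - 1)"
  proof -
    have "(a + b) powr p = (a + b) * (a + b) powr (p - 1)"
      using assms by (simp add: powr_diff)
    also have "\<dots> \<le> (a + b) * a powr (p - 1)"
      using assms by (intro mult_left_mono powr_mono2') auto
    finally show ?thesis .
  qed
  moreover have "a * a powr (p - 1) = a powr p" using assms by (simp add: powr_diff)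
  moreover have "b * a powr (p - 1) \<le> b * 1"
    using assms powr_mono2'[of "p - 1" 1 a] by (intro mult_left_mono) auto
  ultimately have 1: "(a + b) powr p - a powr p \<le> b" by (simp add: algebra_simps)
  have "(a + b) powr p = a * (a + b) powr (p - 1) + b * (a + b) powr (p - 1)"
    using assms by (simp add: powr_diff add_divide_distrib[symmetric] distrib_right[symmetric])
  also have "\<dots> \<le> a * a powr (p - 1) + b * b powr (p - 1)"
    using assms b by (intro add_mono mult_left_mono powr_mono2') auto
  also have "\<dots> = a powr p + b powr p" using assms b by (simp add: powr_diff)
  finally show ?thesis using 1 by simp
qed simp

text \<open>The summand \<open>1\<close> keeps the base of the power away from \<open>0\<close>; with \<open>norm x powr (2 * p)\<close>
  the second differences at the origin would be of order \<open>norm v powr (2 * p)\<close> instead of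
  quadratic.\<close>

definition barrier :: "real \<Rightarrow> 'a::real_inner \<Rightarrow> real" where
  "barrier p x = (1 + (norm x)\<^sup>2) powr p"

lemma barrier_nonneg: "0 \<le> barrier p x"
  by (simp add: barrier_def)

lemma continuous_on_barrier: "continuous_on A (barrier p)"
  unfolding barrier_def by (intro continuous_intros) (auto simp: add_nonneg_eq_0_iff)

lemma concave_on_powr:
  fixes p :: real
  assumes "0 \<le> p" "p \<le> 1"
  shows "concave_on {0<..} (\<lambda>t. t powr p)"
proof (rule f''_le0_imp_concave)
  fix t :: real assume t: "t \<in> {0<..}"
  show "((\<lambda>t. t powr p) has_real_derivative p * t powr (p - 1)) (at t)"
    using t by (auto intro!: derivative_eq_intros)
  show "((\<lambda>t. p * t powr (p - 1)) has_real_derivative p * ((p - 1) * t powr (p - 1 - 1))) (at t)"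
    using t by (auto intro!: derivative_eq_intros)
  show "p * ((p - 1) * t powr (p - 1 - 1)) \<le> 0"
    using assms by (intro mult_nonneg_nonpos mult_nonpos_nonneg) auto
qed simp

text \<open>By the parallelogram law the arguments \<open>1 + |x + v|\<^sup>2\<close> and \<open>1 + |x - v|\<^sup>2\<close> of the power have
  midpoint \<open>1 + |x|\<^sup>2 + |v|\<^sup>2\<close>. Concavity of the power removes the first-order term
  \<open>x \<bullet> v\<close>, which is what makes the bound uniform in \<open>x\<close> and quadratic for small \<open>v\<close>.\<close>

lemma barrier_second_difference_le:
  fixes x v :: "'a::real_inner"
  assumes "0 < p" "p \<le> 1"
  shows "barrier p (x + v) + barrier p (x - v) - 2 * barrier p x
           \<le> 2 * min ((norm v)\<^sup>2) (norm v powr (2 * p))"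
proof -
  define A where "A = 1 + (norm (x + v))\<^sup>2"
  define B where "B = 1 + (norm (x - v))\<^sup>2"
  define M where "M = 1 + (norm x)\<^sup>2 + (norm v)\<^sup>2"
  have M: "(1 - 1/2) *\<^sub>R A + (1/2) *\<^sub>R B = M"
    unfolding A_def B_def M_def by (simp add: power2_norm_eq_inner inner_left_distrib inner_right_distrib
        inner_diff_left inner_diff_right inner_commute field_simps)
  have "0 < A" "0 < B" unfolding A_def B_def by (simp_all add: add_pos_nonneg)
  then have "A powr p + B powr p \<le> 2 * M powr p"
    using concave_onD[OF concave_on_powr[of p], of "1/2" A B] assms M by simp
  moreover have "((norm v)\<^sup>2) powr p = norm v powr (2 * p)"
    by (cases "v = 0") (simp_all flip: powr_powr)
  then have "M powr p - (1 + (norm x)\<^sup>2) powr p \<le> min ((norm v)\<^sup>2) (norm v powr (2 * p))"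
    using powr_increment_le[of "1 + (norm x)\<^sup>2" "(norm v)\<^sup>2" p] assms by (simp add: M_def)
  ultimately show ?thesis unfolding barrier_def A_def B_def by linarith
qed

section \<open>Maxima of the penalized function\<close>

text \<open>The additive constant \<open>c\<close> allows the value at the origin to be beaten outside a ball, which
  confines the search for a maximum to a compact set. The proof divides by \<open>t powr (2 * p)\<close>,
  \<open>t = norm x\<close>, after which every term on the left tends to zero.\<close>

lemma barrier_dominates_growth:
  fixes K \<kappa> p \<epsilon> c :: real
  assumes "0 \<le> \<kappa>" "\<kappa> < 2 * p" "0 < \<epsilon>"
  obtains R where "\<And>x::'a::real_inner. R \<le> norm x \<Longrightarrow> K * growth \<kappa> x + c \<le> \<epsilon> * barrier p x"
proof -
  have "((\<lambda>t::real. K * (t powr (- (2*p)) + t powr (\<kappa> - 2*p)) + c * t powr (- (2*p)))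
          \<longlongrightarrow> K * (0 + 0) + c * 0) at_top"
    using assms by (intro tendsto_intros tendsto_neg_powr filterlim_ident) auto
  then have "eventually (\<lambda>t::real. K * (t powr (- (2*p)) + t powr (\<kappa> - 2*p))
               + c * t powr (- (2*p)) < \<epsilon>) at_top"
    using assms(3) by (simp add: order_tendstoD)
  then have "eventually (\<lambda>t::real. 0 < t \<and> K * (t powr (- (2*p)) + t powr (\<kappa> - 2*p))
               + c * t powr (- (2*p)) < \<epsilon>) at_top"
    using eventually_gt_at_top[of 0] by eventually_elim auto
  then obtain R where R: "\<And>t. R \<le> t \<Longrightarrow> 0 < t \<and> K * (t powr (- (2*p)) + t powr (\<kappa> - 2*p))
               + c * t powr (- (2*p)) < \<epsilon>"
    unfolding eventually_at_top_linorder by blast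
  show ?thesis
  proof (rule that[of R])
    fix x :: 'a assume "R \<le> norm x"
    note t = R[OF this]
    define t where "t = norm x"
    have t0: "0 < t" and lt: "K * (t powr (- (2*p)) + t powr (\<kappa> - 2*p)) + c * t powr (- (2*p)) < \<epsilon>"
      using t by (auto simp: t_def)
    have "K * growth \<kappa> x + c = (K * (t powr (- (2*p)) + t powr (\<kappa> - 2*p)) + c * t powr (- (2*p)))
            * t powr (2*p)"
      using t0 by (simp add: growth_def t_def[symmetric] distrib_right mult.assoc
          powr_add[symmetric] distrib_left)
    also have "\<dots> \<le> \<epsilon> * t powr (2*p)" using lt by (intro mult_right_mono) auto
    also have "t powr (2*p) = (t\<^sup>2) powr p" using t0 by (simp flip: powr_powr)
    also have "\<epsilon> * (t\<^sup>2) powr p \<le> \<epsilon> * barrier p x"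
      unfolding barrier_def t_def[symmetric] using assms
      by (intro mult_left_mono powr_mono2) auto
    finally show "K * growth \<kappa> x + c \<le> \<epsilon> * barrier p x" .
  qed
qed

lemma penalized_attains_max:
  fixes u :: "'a::euclidean_space \<Rightarrow> real"
  assumes "continuous_on UNIV u" "\<And>x. u x \<le> K * growth \<kappa> x"
    and "0 \<le> \<kappa>" "\<kappa> < 2 * p" "0 < \<epsilon>"
  obtains z where "\<And>y. u y - \<epsilon> * barrier p y \<le> u z - \<epsilon> * barrier p z"
proof -
  define w where "w y = u y - \<epsilon> * barrier p y" for y
  obtain R where R: "\<And>x::'a. R \<le> norm x \<Longrightarrow> K * growth \<kappa> x + (- w 0) \<le> \<epsilon> * barrier p x"
    using barrier_dominates_growth[OF assms(3-5)] by blast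
  have "continuous_on (cball 0 (max R 0)) w" unfolding w_def
    by (intro continuous_intros continuous_on_barrier continuous_on_subset[OF assms(1)]) auto
  then obtain z where "\<forall>y\<in>cball 0 (max R 0). w y \<le> w z"
    using continuous_attains_sup[of "cball 0 (max R 0)" w] by force
  then have z: "w y \<le> w z" if "norm y \<le> max R 0" for y using that by simp
  have "w y \<le> w z" for y
  proof (cases "norm y \<le> max R 0")
    case False
    then have "w y \<le> w 0" using R[of y] assms(2)[of y] unfolding w_def by linarith
    also have "w 0 \<le> w z" using z[of 0] by simp
    finally show ?thesis .
  qed (use z in simp)
  then show ?thesis using that unfolding w_def by blast
qed

section \<open>An integrable majorant of the kernel\<close>

text \<open>Near the origin the quotient behaves like \<open>\<bar>r\<bar> powr (1 - 2 * s)\<close>, integrable because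
  \<open>s < 1\<close>; at infinity it behaves like \<open>\<bar>r\<bar> powr (2 * p - 1 - 2 * s)\<close>, integrable because
  \<open>p < s\<close>.\<close>

lemma integrable_levy_kernel_bound:
  fixes s p :: real
  assumes "s < 1" "p < s"
  shows "\<exists>H. integrable lborel H \<and>
           (\<forall>r. 2 * min (r\<^sup>2) (\<bar>r\<bar> powr (2 * p)) / \<bar>r\<bar> powr (1 + 2 * s) \<le> H r)"
proof -
  define g1 where "g1 r = indicator {0..1::real} r *\<^sub>R (r powr (1 - 2 * s))" for r
  define g2 where "g2 r = indicator {1::real..} r *\<^sub>R (r powr (2 * p - 1 - 2 * s))" for r
  have "integrable lebesgue g1" unfolding g1_def
    by (intro nonnegative_absolutely_integrable_1[unfolded set_integrable_def]
        integrable_on_powr_from_0) (use assms in auto)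
  moreover have "g1 \<in> borel_measurable borel" unfolding g1_def by measurable
  ultimately have g1: "integrable lborel g1" by (simp add: integrable_completion)
  have "integrable lebesgue g2" unfolding g2_def
    by (intro nonnegative_absolutely_integrable_1[unfolded set_integrable_def]
        has_integral_integrable[OF has_integral_powr_to_inf]) (use assms in auto)
  moreover have "g2 \<in> borel_measurable borel" unfolding g2_def by measurable
  ultimately have g2: "integrable lborel g2" by (simp add: integrable_completion)
  define g where "g r = 2 * (g1 r + g2 r)" for r
  have g: "integrable lborel g" unfolding g_def using g1 g2 by simp
  have g_nonneg: "0 \<le> g r" for r by (simp add: g_def g1_def g2_def)
  have bound: "2 * min (r\<^sup>2) (\<bar>r\<bar> powr (2 * p)) / \<bar>r\<bar> powr (1 + 2 * s) \<le> g \<bar>r\<bar>" for r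
  proof (cases "r = 0")
    case False
    define t where "t = \<bar>r\<bar>"
    have t: "0 < t" "r\<^sup>2 = t powr 2" using False by (simp_all add: t_def)
    have e1: "t powr 2 / t powr (1 + 2 * s) = t powr (1 - 2 * s)"
      by (simp flip: powr_diff)
    have e2: "t powr (2 * p) / t powr (1 + 2 * s) = t powr (2 * p - 1 - 2 * s)"
      by (simp flip: powr_diff add: diff_diff_eq)
    have "2 * min (r\<^sup>2) (t powr (2 * p)) / t powr (1 + 2 * s)
            = 2 * min (t powr (1 - 2 * s)) (t powr (2 * p - 1 - 2 * s))"
      unfolding t(2) e1[symmetric] e2[symmetric] using t(1) by (auto simp: min_def divide_le_cancel)
    also have "\<dots> \<le> g t"
      using t(1) by (cases "t \<le> 1") (auto simp: g_def g1_def g2_def indicator_def)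
    finally show ?thesis by (simp add: t_def)
  qed (simp add: g_nonneg)
  \<comment> \<open>\<open>g\<close> lives on the positive half-line; adding its reflection covers \<open>r < 0\<close>. The reflection is
     written as an affine map to match the change of variables for Lebesgue measure.\<close>
  show ?thesis
  proof (intro exI[of _ "\<lambda>r. g r + g (0 + (-1) * r)"] conjI allI)
    show "integrable lborel (\<lambda>r. g r + g (0 + (-1) * r))"
      using g by (intro Bochner_Integration.integrable_add lborel_integrable_real_affine) auto
    fix r :: real
    have "g \<bar>r\<bar> \<le> g r + g (0 + (-1) * r)"
      using g_nonneg[of r] g_nonneg[of "-r"] by (simp add: abs_if)
    with bound[of r]
    show "2 * min (r\<^sup>2) (\<bar>r\<bar> powr (2 * p)) / \<bar>r\<bar> powr (1 + 2 * s) \<le> g r + g (0 + (-1) * r)"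
      by simp
  qed
qed

section \<open>The operator at a penalized maximum\<close>

lemma spectral_measure_space:
  "spectral_measure s l L \<mu> \<Longrightarrow> space \<mu> = sphere 0 1"
  unfolding spectral_measure_def
  by (metis sets_eq_imp_space_eq space_restrict_space space_borel Int_UNIV_right)

lemma spectral_measure_finite:
  assumes "spectral_measure s l L \<mu>"
  shows "finite_measure \<mu>"
proof
  have "emeasure \<mu> (space \<mu>) \<le> ennreal L"
    using assms spectral_measure_space[OF assms] by (simp add: spectral_measure_def)
  then show "emeasure \<mu> (space \<mu>) \<noteq> \<infinity>" by (metis ennreal_neq_top infinity_ennreal_def neq_top_trans)
qed

lemma integrable_snd_finite_measure:
  fixes H :: "'b \<Rightarrow> real"
  assumes "finite_measure M" "sigma_finite_measure N" "integrable N H"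
  shows "integrable (M \<Otimes>\<^sub>M N) (\<lambda>(\<theta>, r). H r)"
proof -
  interpret M: finite_measure M by fact
  interpret N: sigma_finite_measure N by fact
  interpret pair_sigma_finite M N ..
  note [measurable] = borel_measurable_integrable[OF assms(3)]
  show ?thesis
    by (rule Fubini_integrable) (use assms(3) in auto)
qed

text \<open>On the sphere \<open>norm (r *\<^sub>R \<theta>) = \<bar>r\<bar>\<close>, so the bound on the second differences of the
  barrier turns into the majorant \<open>H\<close>, a function of \<open>r\<close> alone. Its integral depends neither on \<open>z\<close>
  nor on \<open>\<epsilon>\<close>, so the bound vanishes as \<open>\<epsilon> \<rightarrow> 0\<close> although \<open>z\<close> may escape to infinity.\<close>

lemma stable_op_le_at_penalized_max:
  fixes u :: "real ^ 'n \<Rightarrow> real"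
  assumes "spectral_measure s l L \<mu>" "integrable (\<mu> \<Otimes>\<^sub>M lborel) (stable_integrand s u z)"
    and "0 < p" "p \<le> 1" "0 \<le> \<epsilon>"
    and max: "\<And>y. u y - \<epsilon> * barrier p y \<le> u z - \<epsilon> * barrier p z"
    and H: "integrable lborel H"
      "\<And>r. 2 * min (r\<^sup>2) (\<bar>r\<bar> powr (2 * p)) / \<bar>r\<bar> powr (1 + 2 * s) \<le> H r"
  shows "stable_op s \<mu> u z \<le> \<epsilon> * (\<integral>q. (case q of (\<theta>, r) \<Rightarrow> H r) \<partial>(\<mu> \<Otimes>\<^sub>M lborel))"
proof -
  have intH: "integrable (\<mu> \<Otimes>\<^sub>M lborel) (\<lambda>(\<theta>, r). H r)"
    by (intro integrable_snd_finite_measure spectral_measure_finite[OF assms(1)] H(1)) unfold_locales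
  have "stable_op s \<mu> u z \<le> (\<integral>q. \<epsilon> * (case q of (\<theta>, r) \<Rightarrow> H r) \<partial>(\<mu> \<Otimes>\<^sub>M lborel))"
    unfolding stable_op_def
  proof (rule integral_mono)
    fix q :: "(real ^ 'n) \<times> real" assume "q \<in> space (\<mu> \<Otimes>\<^sub>M lborel)"
    then obtain \<theta> r where q: "q = (\<theta>, r)" and "\<theta> \<in> space \<mu>" by (auto simp: space_pair_measure)
    then have norm: "norm (r *\<^sub>R \<theta>) = \<bar>r\<bar>" by (simp add: spectral_measure_space[OF assms(1)])
    have "u (z + r *\<^sub>R \<theta>) + u (z - r *\<^sub>R \<theta>) - 2 * u z
            \<le> \<epsilon> * (barrier p (z + r *\<^sub>R \<theta>) + barrier p (z - r *\<^sub>R \<theta>) - 2 * barrier p z)"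
      using max[of "z + r *\<^sub>R \<theta>"] max[of "z - r *\<^sub>R \<theta>"] by (simp add: algebra_simps)
    also have "\<dots> \<le> \<epsilon> * (2 * min (r\<^sup>2) (\<bar>r\<bar> powr (2 * p)))"
      using barrier_second_difference_le[OF assms(3,4), of z "r *\<^sub>R \<theta>"] \<open>0 \<le> \<epsilon>\<close>
      by (intro mult_left_mono) (auto simp only: norm power2_abs)
    finally have "stable_integrand s u z q
        \<le> \<epsilon> * (2 * min (r\<^sup>2) (\<bar>r\<bar> powr (2 * p))) / \<bar>r\<bar> powr (1 + 2 * s)"
      unfolding q stable_integrand_def by (simp add: divide_right_mono)
    also have "\<dots> = \<epsilon> * (2 * min (r\<^sup>2) (\<bar>r\<bar> powr (2 * p)) / \<bar>r\<bar> powr (1 + 2 * s))" by simp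
    also have "\<dots> \<le> \<epsilon> * H r" using H(2)[of r] \<open>0 \<le> \<epsilon>\<close> by (rule mult_left_mono)
    finally show "stable_integrand s u z q \<le> \<epsilon> * (case q of (\<theta>, r) \<Rightarrow> H r)" by (simp add: q)
  qed (use assms(2) intH in auto)
  then show ?thesis by simp
qed

section \<open>Sign of the operator\<close>

lemma stable_op_nonpos_if_growth_above:
  fixes u :: "real ^ 'n \<Rightarrow> real"
  assumes s: "0 < s" "s < 1"
    and mu: "spectral_measure s l L \<mu>"
    and f: "continuous_on UNIV f" "mono f"
    and u: "continuous_on UNIV u" "solution s \<mu> f u"
    and growth: "0 \<le> \<kappa>" "\<kappa> < 2 * s" "\<And>x. u x \<le> K * growth \<kappa> x"
  shows "stable_op s \<mu> u x \<le> 0"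
proof -
  \<comment> \<open>Any exponent with \<open>\<kappa> < 2 * p < 2 * s\<close> works; this is the midpoint.\<close>
  define p where "p = (\<kappa> / 2 + s) / 2"
  have p: "0 < p" "p \<le> 1" "p < s" "\<kappa> < 2 * p" using s growth by (auto simp: p_def field_simps)
  obtain H where H: "integrable lborel H"
      "\<And>r. 2 * min (r\<^sup>2) (\<bar>r\<bar> powr (2 * p)) / \<bar>r\<bar> powr (1 + 2 * s) \<le> H r"
    using integrable_levy_kernel_bound[OF s(2) p(3)] by blast
  define C where "C = (\<integral>q. (case q of (\<theta>, r) \<Rightarrow> H r) \<partial>(\<mu> \<Otimes>\<^sub>M lborel))"
  have key: "f (u x - \<epsilon> * barrier p x) \<le> \<epsilon> * C" if \<epsilon>: "0 < \<epsilon>" for \<epsilon>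
  proof -
    obtain z where z: "\<And>y. u y - \<epsilon> * barrier p y \<le> u z - \<epsilon> * barrier p z"
      using penalized_attains_max[OF u(1) growth(3) growth(1) p(4) \<epsilon>] by blast
    have "0 \<le> \<epsilon> * barrier p z" using \<epsilon> by (simp add: barrier_nonneg)
    then have "u x - \<epsilon> * barrier p x \<le> u z" using z[of x] by linarith
    then have "f (u x - \<epsilon> * barrier p x) \<le> f (u z)" by (rule monoD[OF f(2)])
    also have "f (u z) = stable_op s \<mu> u z" using u(2) by (simp add: solution_def)
    also have "\<dots> \<le> \<epsilon> * C" unfolding C_def
      using u(2) \<epsilon> by (intro stable_op_le_at_penalized_max[OF mu _ p(1,2) _ z H])
        (auto simp: solution_def)
    finally show ?thesis .
  qed
  have "((\<lambda>\<epsilon>. f (u x - \<epsilon> * barrier p x)) \<longlongrightarrow> f (u x - 0 * barrier p x)) (at_right 0)"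
    by (rule continuous_on_tendsto_compose[OF f(1)]) (intro tendsto_intros always_eventually | simp)+
  moreover have "((\<lambda>\<epsilon>. \<epsilon> * C) \<longlongrightarrow> 0 * C) (at_right 0)" by (intro tendsto_intros)
  moreover have "\<forall>\<^sub>F \<epsilon> in at_right 0. f (u x - \<epsilon> * barrier p x) \<le> \<epsilon> * C"
    using key by (auto intro: eventually_mono[OF eventually_at_right_less])
  ultimately have "f (u x - 0 * barrier p x) \<le> 0 * C"
    by (intro tendsto_le[of "at_right 0"]) auto
  then show ?thesis using u(2) by (simp add: solution_def)
qed

lemma C2_imp_continuous_on: "C2 u \<Longrightarrow> continuous_on UNIV u"
  unfolding C2_def by (meson continuous_at_imp_continuous_on has_derivative_continuous)

lemma stable_integrand_uminus:
  "stable_integrand s (\<lambda>y. - u y) x = (\<lambda>q. - stable_integrand s u x q)"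
  by (auto simp: stable_integrand_def fun_eq_iff minus_divide_left)

lemma stable_op_uminus: "stable_op s \<mu> (\<lambda>y. - u y) x = - stable_op s \<mu> u x"
  by (simp add: stable_op_def stable_integrand_uminus)

lemma solution_uminus:
  "solution s \<mu> f u \<Longrightarrow> solution s \<mu> (\<lambda>t. - f (- t)) (\<lambda>y. - u y)"
  by (simp add: solution_def stable_op_uminus stable_integrand_uminus)

theorem theorem2:
  fixes s l L :: real
    and \<mu> :: "(real ^ 'n) measure"
    and f :: "real \<Rightarrow> real"
    and u :: "real ^ 'n \<Rightarrow> real"
  assumes "0 < s" and "s < 1"
    and "0 < l" and "0 < L"
    and "spectral_measure s l L \<mu>"
    and "continuous_on UNIV f" and "mono f"
    and "C2 u"
    and "solution s \<mu> f u"
  shows "((\<exists>K \<kappa>. 0 \<le> K \<and> 0 \<le> \<kappa> \<and> \<kappa> < 2 * s \<and> (\<forall>x. u x \<le> K * growth \<kappa> x))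
            \<longrightarrow> (\<forall>x. stable_op s \<mu> u x \<le> 0)) \<and>
         ((\<exists>K \<kappa>. 0 \<le> K \<and> 0 \<le> \<kappa> \<and> \<kappa> < 2 * s \<and> (\<forall>x. u x \<ge> - K * growth \<kappa> x))
            \<longrightarrow> (\<forall>x. stable_op s \<mu> u x \<ge> 0))"
proof (intro conjI impI allI; elim exE conjE)
  have cont: "continuous_on UNIV u" by (rule C2_imp_continuous_on) fact
  fix x and K \<kappa> :: real
  assume \<kappa>: "0 \<le> \<kappa>" "\<kappa> < 2 * s"
  show "stable_op s \<mu> u x \<le> 0" if "\<forall>x. u x \<le> K * growth \<kappa> x"
    using stable_op_nonpos_if_growth_above[OF assms(1,2,5,6,7) cont assms(9) \<kappa>] that by blast
  show "stable_op s \<mu> u x \<ge> 0" if "\<forall>x. u x \<ge> - K * growth \<kappa> x"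
  proof -
    have "stable_op s \<mu> (\<lambda>y. - u y) x \<le> 0"
    proof (rule stable_op_nonpos_if_growth_above[OF assms(1,2,5) _ _ _ solution_uminus \<kappa>])
      show "continuous_on UNIV (\<lambda>t. - f (- t))"
        by (intro continuous_intros continuous_on_compose2[OF assms(6)]) auto
      show "mono (\<lambda>t. - f (- t))" using assms(7) by (auto simp: mono_def)
      show "continuous_on UNIV (\<lambda>y. - u y)" by (intro continuous_intros cont)
      show "- u y \<le> K * growth \<kappa> y" for y using that[rule_format, of y] by simp
    qed fact
    then show ?thesis by (simp add: stable_op_uminus)
  qed
qed

end
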